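(* Let $\{X_n\}_{n\ge0}$ be an irreducible Markov chain with state space $\{1,2,3\}$, transition matrix $P=[p_{ij}]$ and stationary distribution $(\pi_1,\pi_2,\pi_3)$. The distribution $g_{1,n}=P\{T_1^{(1)}=n\mid X_0=1\}$ of the mixing time $T_1^{(1)}$ is given by $$g_{1,1}=\pi_1p_{11}+\pi_2p_{12}+\pi_3p_{13},$$ $$g_{1,2}=\pi_1(p_{12}p_{21}+p_{13}p_{31})+\pi_2(p_{11}p_{12}+p_{13}p_{32})+\pi_3(p_{11}p_{13}+p_{12}p_{23}),$$ and, for $n\ge3$, provided $\delta_1>0$, $\delta_2>0$ and $\delta_3>0$, $$g_{1,n}=\pi_1\left(\frac{c(\lambda_{12})}{\lambda_{12}-\lambda_{13}}\lambda_{12}^{n-2}-\frac{c(\lambda_{13})}{\lambda_{12}-\lambda_{13}}\lambda_{13}^{n-2}\right)+\pi_2\left(\frac{a(\lambda_{21})}{\lambda_{21}-\lambda_{23}}\lambda_{21}^{n-1}-\frac{a(\lambda_{23})}{\lambda_{21}-\lambda_{23}}\lambda_{23}^{n-1}\right)+\pi_3\left(\frac{b(\lambda_{31})}{\lambda_{31}-\lambda_{32}}\lambda_{31}^{n-1}-\frac{b(\lambda_{32})}{\lambda_{31}-\lambda_{32}}\lambda_{32}^{n-1}\right),$$ where $$\lambda_{12}=\frac{p_{22}+p_{33}+\delta_1}{2},\quad\lambda_{13}=\frac{p_{22}+p_{33}-\delta_1}{2},\quad\delta_1=\sqrt{(p_{22}-p_{33})^2+4p_{23}p_{32}},$$ $$\lambda_{21}=\frac{p_{11}+p_{33}+\delta_2}{2},\quad\lambda_{23}=\frac{p_{11}+p_{33}-\delta_2}{2},\quad\delta_2=\sqrt{(p_{11}-p_{33})^2+4p_{13}p_{31}},$$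 $$\lambda_{31}=\frac{p_{11}+p_{22}+\delta_3}{2},\quad\lambda_{32}=\frac{p_{11}+p_{22}-\delta_3}{2},\quad\delta_3=\sqrt{(p_{11}-p_{22})^2+4p_{12}p_{21}},$$ $$a(\lambda)=p_{12}\lambda+p_{13}p_{32}-p_{12}p_{33},\qquad b(\lambda)=p_{13}\lambda+p_{12}p_{23}-p_{13}p_{22},$$ $$c(\lambda)=(1-p_{11})(1-p_{22})(1-p_{33})-p_{23}p_{32}(1-p_{11})-(p_{12}p_{21}+p_{13}p_{31})(1-\lambda).$$
   Context: The mixing variable $M$ is a random variable, independent of the chain, with $P[M=j]=\pi_j$ for $j\in\{1,2,3\}$. Given $X_0=1$, $T_1^{(1)}=\min\{n\ge1:X_n=M\}$. *)

theory Defs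
  imports "HOL-Analysis.Analysis" "HOL-Probability.Probability"
begin

text \<open>
  Discrete-time, time-homogeneous Markov chains on a finite state type. The entry
  \<open>P $ i $ j\<close> (row \<open>i\<close>, column \<open>j\<close>) is the one-step probability from \<open>i\<close> to \<open>j\<close>.
  The state space \<open>{1, 2, 3}\<close> is the numeral type \<open>3\<close>; its arithmetic is modulo 3
  (so \<open>3 = 0\<close> there), but it is used only as a set of three labels, cf. \<open>UNIV_3\<close>.
\<close>

definition stochastic_matrix :: "real^'s^'s \<Rightarrow> bool" where
  "stochastic_matrix P \<longleftrightarrow> (\<forall>i j. 0 \<le> P $ i $ j) \<and> (\<forall>i. (\<Sum>j\<in>UNIV. P $ i $ j) = 1)"

text \<open>
  The conditioning event fixes the whole past; since \<open>cond_prob\<close> is \<open>0\<close> when conditioning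
  on a null event, the Markov property is required only for pasts of positive probability.
  The initial distribution is arbitrary.
\<close>

definition markov_chain ::
    "'w measure \<Rightarrow> (nat \<Rightarrow> 'w \<Rightarrow> 's::finite) \<Rightarrow> real^'s^'s \<Rightarrow> bool" where
  "markov_chain \<Omega> X P \<longleftrightarrow>
     prob_space \<Omega> \<and> stochastic_matrix P \<and>
     (\<forall>n. X n \<in> \<Omega> \<rightarrow>\<^sub>M count_space UNIV) \<and>
     (\<forall>n s j. \<P>(\<omega> in \<Omega>. \<forall>k\<le>n. X k \<omega> = s k) > 0 \<longrightarrow>
        \<P>(\<omega> in \<Omega>. X (Suc n) \<omega> = j \<bar> \<forall>k\<le>n. X k \<omega> = s k) = P $ s n $ j)"

text \<open>
  The power \<open>A ^ n\<close> would be componentwise on \<open>real^'s^'s\<close>, so matrix powers are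
  written as iterated \<open>(**)\<close>.
\<close>

definition mat_power :: "real^'s^'s \<Rightarrow> nat \<Rightarrow> real^'s^'s" where
  "mat_power A n = (((**) A) ^^ n) (mat 1)"

definition irreducible_chain :: "real^'s^'s \<Rightarrow> bool" where
  "irreducible_chain P \<longleftrightarrow> (\<forall>i j. \<exists>n. mat_power P n $ i $ j > 0)"

definition stationary_distribution :: "real^'s^'s \<Rightarrow> real^'s \<Rightarrow> bool" where
  "stationary_distribution P \<pi> \<longleftrightarrow>
     (\<forall>j. 0 \<le> \<pi> $ j) \<and> (\<Sum>j\<in>UNIV. \<pi> $ j) = 1 \<and> \<pi> v* P = \<pi>"

text \<open>
  A mixing variable for the chain: \<open>\<pi>\<close>-distributed and independent of the whole process,
  viewed as one random element of the product space. Independence is stated for the generated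
  sigma-algebras because \<open>indep_var\<close> needs both variables to have the same value type.
\<close>

definition mixing_variable ::
    "'w measure \<Rightarrow> (nat \<Rightarrow> 'w \<Rightarrow> 's::finite) \<Rightarrow> real^'s \<Rightarrow> ('w \<Rightarrow> 's) \<Rightarrow> bool" where
  "mixing_variable \<Omega> X \<pi> M \<longleftrightarrow>
     M \<in> \<Omega> \<rightarrow>\<^sub>M count_space UNIV \<and>
     (\<forall>j. \<P>(\<omega> in \<Omega>. M \<omega> = j) = \<pi> $ j) \<and>
     prob_space.indep_set \<Omega>
       (sets (vimage_algebra (space \<Omega>) M (count_space UNIV)))
       (sets (vimage_algebra (space \<Omega>) (\<lambda>\<omega> n. X n \<omega>) (\<Pi>\<^sub>M n\<in>UNIV. count_space UNIV)))"

text \<open>\<open>min {n \<ge> 1. X n = M}\<close>, with value \<open>\<infinity>\<close> if the chain never hits \<open>M\<close> after time \<open>0\<close>.\<close>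

definition mixing_time :: "(nat \<Rightarrow> 'w \<Rightarrow> 's) \<Rightarrow> ('w \<Rightarrow> 's) \<Rightarrow> 'w \<Rightarrow> enat" where
  "mixing_time X M \<omega> = Inf (enat ` {n. n \<ge> 1 \<and> X n \<omega> = M \<omega>})"

end

theory Submission
  imports Defs
begin

text \<open>
  Conditioning on \<open>M = j\<close> reduces \<open>g n\<close> to the mixture, with weights \<open>\<pi> $ j\<close>, of the first
  passage probabilities from \<open>1\<close> to \<open>j\<close>. Deleting state \<open>j\<close> leaves a \<open>2 \<times> 2\<close> substochastic
  matrix \<open>B\<close>, so by Cayley--Hamilton these probabilities satisfy the linear recurrence whose
  characteristic roots are the eigenvalues of \<open>B\<close>; two initial values determine them.
\<close>

text \<open>\<open>first_passage P i j n j\<close> is the probability of first hitting \<open>j\<close> from \<open>i\<close> at time \<open>n + 1\<close>;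
  the last argument is kept free so that the recursion runs forward in time.\<close>

primrec first_passage :: "real^'s^'s \<Rightarrow> 's \<Rightarrow> 's::finite \<Rightarrow> nat \<Rightarrow> 's \<Rightarrow> real" where
  "first_passage P i j 0 l = P $ i $ l"
| "first_passage P i j (Suc n) l = (\<Sum>k\<in>UNIV - {j}. first_passage P i j n k * P $ k $ l)"

section \<open>Probabilities of path events of the chain\<close>

text \<open>The defining property of the chain conditions on a complete history up to time
  \<open>n\<close>. The assumption on \<open>Q\<close> makes it an event of that past, so it splits
  into finitely many disjoint histories ending in \<open>i\<close>, each of which contributes the
  same factor \<open>P $ i $ j\<close>.\<close>

lemma markov_chain_step:
  fixes X :: "nat \<Rightarrow> 'w \<Rightarrow> 's::finite"
  assumes chain: "markov_chain \<Omega> X P"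
    and Q: "\<And>s t. (\<And>k. k \<le> n \<Longrightarrow> s k = t k) \<Longrightarrow> Q s \<Longrightarrow> Q t"
  shows "\<P>(\<omega> in \<Omega>. Q (\<lambda>k. X k \<omega>) \<and> X n \<omega> = i \<and> X (Suc n) \<omega> = j)
       = \<P>(\<omega> in \<Omega>. Q (\<lambda>k. X k \<omega>) \<and> X n \<omega> = i) * P $ i $ j"
proof -
  interpret prob_space \<Omega>
    using chain by (simp add: markov_chain_def)
  have X[measurable]: "\<And>n. X n \<in> \<Omega> \<rightarrow>\<^sub>M count_space UNIV"
    using chain by (simp add: markov_chain_def)
  \<comment> \<open>Histories are extensional functions on \<open>{..n}\<close>: this makes
    \<open>S\<close> finite, and distinct members differ at some time up to
    \<open>n\<close>.\<close>
  define S where "S = {s \<in> PiE {..n} (\<lambda>_. UNIV). Q s \<and> s n = i}"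
  define A where "A s = {\<omega> \<in> space \<Omega>. \<forall>k\<le>n. X k \<omega> = s k}" for s
  define B where "B s = {\<omega> \<in> space \<Omega>. X (Suc n) \<omega> = j \<and> (\<forall>k\<le>n. X k \<omega> = s k)}" for s
  have finS: "finite S"
    unfolding S_def by (rule finite_subset[of _ "PiE {..n} (\<lambda>_. UNIV)"]) (auto intro: finite_PiE)
  have A[measurable]: "A s \<in> sets \<Omega>" and B[measurable]: "B s \<in> sets \<Omega>" for s
    unfolding A_def B_def by measurable
  have disj: "s = t" if "s \<in> S" "t \<in> S" "\<And>k. k \<le> n \<Longrightarrow> s k = t k" for s t
    using that unfolding S_def by (auto intro!: PiE_ext[of s "{..n}" _ t])
  have dA: "disjoint_family_on A S"
    unfolding disjoint_family_on_def
  proof (intro ballI impI, rule ccontr)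
    fix s t assume st: "s \<in> S" "t \<in> S" "s \<noteq> t" and "A s \<inter> A t \<noteq> {}"
    then obtain \<omega> where "\<omega> \<in> A s" "\<omega> \<in> A t"
      by blast
    then have "s k = t k" if "k \<le> n" for k
      using that by (simp add: A_def)
    with disj st show False
      by blast
  qed
  moreover have "B s \<subseteq> A s" for s
    by (auto simp: A_def B_def)
  ultimately have dB: "disjoint_family_on B S"
    unfolding disjoint_family_on_def by blast
  have path: "restrict (\<lambda>k. X k \<omega>) {..n} \<in> S" if "Q (\<lambda>k. X k \<omega>)" "X n \<omega> = i" for \<omega>
    using that Q[of "\<lambda>k. X k \<omega>" "restrict (\<lambda>k. X k \<omega>) {..n}"] by (auto simp: S_def)
  have Qpath: "Q (\<lambda>k. X k \<omega>)" if "s \<in> S" "\<And>k. k \<le> n \<Longrightarrow> X k \<omega> = s k" for s \<omega>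
    using that Q[of s "\<lambda>k. X k \<omega>"] by (auto simp: S_def)
  have UA: "{\<omega> \<in> space \<Omega>. Q (\<lambda>k. X k \<omega>) \<and> X n \<omega> = i} = (\<Union>s\<in>S. A s)" (is "?L = ?R")
  proof
    show "?L \<subseteq> ?R"
    proof
      fix \<omega> assume "\<omega> \<in> ?L"
      then have "restrict (\<lambda>k. X k \<omega>) {..n} \<in> S" "\<omega> \<in> A (restrict (\<lambda>k. X k \<omega>) {..n})"
        using path by (auto simp: A_def)
      then show "\<omega> \<in> ?R" by blast
    qed
    show "?R \<subseteq> ?L"
      using Qpath by (auto simp: A_def S_def)
  qed
  have UB: "{\<omega> \<in> space \<Omega>. Q (\<lambda>k. X k \<omega>) \<and> X n \<omega> = i \<and> X (Suc n) \<omega> = j} = (\<Union>s\<in>S. B s)"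
    using UA by (auto simp: A_def B_def set_eq_iff)
  have AB: "prob (B s) = prob (A s) * P $ i $ j" if s: "s \<in> S" for s
  proof (cases "prob (A s) > 0")
    case True
    then have "\<P>(\<omega> in \<Omega>. X (Suc n) \<omega> = j \<bar> \<forall>k\<le>n. X k \<omega> = s k) = P $ s n $ j"
      using chain by (auto simp: markov_chain_def A_def)
    with True s show ?thesis
      by (auto simp: cond_prob_def A_def B_def S_def field_simps)
  next
    case False
    \<comment> \<open>For a null history the Markov property says nothing; monotonicity makes both
      sides zero.\<close>
    have "prob (B s) \<le> prob (A s)"
      by (intro finite_measure_mono) (auto simp: A_def B_def A[unfolded A_def])
    with False show ?thesis
      by (smt (verit) measure_nonneg mult_eq_0_iff)
  qed
  show ?thesis
    unfolding UA UB using finS dA dB A B AB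
    by (simp add: finite_measure_finite_Union image_subset_iff sum_distrib_right)
qed

lemma prob_first_passage:
  fixes X :: "nat \<Rightarrow> 'w \<Rightarrow> 's::finite"
  assumes chain: "markov_chain \<Omega> X P"
  shows "\<P>(\<omega> in \<Omega>. X 0 \<omega> = i \<and> (\<forall>k\<in>{1..n}. X k \<omega> \<noteq> j) \<and> X (Suc n) \<omega> = l)
       = \<P>(\<omega> in \<Omega>. X 0 \<omega> = i) * first_passage P i j n l"
proof (induction n arbitrary: l)
  case 0
  show ?case
    using markov_chain_step[OF chain, of 0 "\<lambda>_. True" i l] by simp
next
  case (Suc n)
  interpret prob_space \<Omega>
    using chain by (simp add: markov_chain_def)
  have X[measurable]: "\<And>n. X n \<in> \<Omega> \<rightarrow>\<^sub>M count_space UNIV"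
    using chain by (simp add: markov_chain_def)
  \<comment> \<open>\<open>Q\<close> forbids \<open>j\<close> only up to time \<open>n\<close>;
    avoidance at time \<open>Suc n\<close> is carried by the range \<open>UNIV - {j}\<close> of the
    intermediate state \<open>m\<close>.\<close>
  define Q where "Q s \<longleftrightarrow> s 0 = i \<and> (\<forall>k\<in>{1..n}. s k \<noteq> j)" for s :: "nat \<Rightarrow> 's"
  define C where "C m = {\<omega> \<in> space \<Omega>. Q (\<lambda>k. X k \<omega>) \<and> X (Suc n) \<omega> = m \<and> X (Suc (Suc n)) \<omega> = l}" for m
  have C: "C m \<in> sets \<Omega>" for m
    unfolding C_def Q_def by measurable
  have "{\<omega> \<in> space \<Omega>. X 0 \<omega> = i \<and> (\<forall>k\<in>{1..Suc n}. X k \<omega> \<noteq> j) \<and> X (Suc (Suc n)) \<omega> = l}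
      = (\<Union>m\<in>UNIV - {j}. C m)"
    by (auto simp: C_def Q_def atLeastAtMostSuc_conv)
  moreover have "prob (\<Union>m\<in>UNIV - {j}. C m) = (\<Sum>m\<in>UNIV - {j}. prob (C m))"
    using C by (intro finite_measure_finite_Union) (auto simp: disjoint_family_on_def C_def)
  moreover have "prob (C m) = prob {\<omega> \<in> space \<Omega>. X 0 \<omega> = i} * (first_passage P i j n m * P $ m $ l)" for m
  proof -
    have "prob (C m) = \<P>(\<omega> in \<Omega>. Q (\<lambda>k. X k \<omega>) \<and> X (Suc n) \<omega> = m) * P $ m $ l"
      unfolding C_def by (rule markov_chain_step[OF chain]) (auto simp: Q_def)
    also have "\<P>(\<omega> in \<Omega>. Q (\<lambda>k. X k \<omega>) \<and> X (Suc n) \<omega> = m)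
        = prob {\<omega> \<in> space \<Omega>. X 0 \<omega> = i} * first_passage P i j n m"
      using Suc[of m] by (simp add: Q_def conj_assoc)
    finally show ?thesis by simp
  qed
  ultimately show ?case
    by (simp add: sum_distrib_left)
qed

section \<open>The mixing time as a mixture of first passage times\<close>

lemma mixing_time_eq_enat:
  "mixing_time X M \<omega> = enat (Suc n) \<longleftrightarrow> X (Suc n) \<omega> = M \<omega> \<and> (\<forall>k\<in>{1..n}. X k \<omega> \<noteq> M \<omega>)"
proof -
  let ?A = "{n. n \<ge> 1 \<and> X n \<omega> = M \<omega>}"
  have "Inf (enat ` ?A) = enat (Suc n) \<longleftrightarrow> Suc n \<in> ?A \<and> (\<forall>k\<in>?A. Suc n \<le> k)"
  proof
    assume L: "Inf (enat ` ?A) = enat (Suc n)"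
    \<comment> \<open>An empty set of hitting times has infimum infinity, which is excluded here; a
      nonempty one attains its infimum by well-ordering.\<close>
    have "enat ` ?A \<noteq> {}"
    proof
      assume E: "enat ` ?A = {}"
      have "Inf (enat ` ?A) = \<infinity>"
        unfolding E by (simp add: Inf_enat_def)
      with L show False
        by (metis enat.distinct(1))
    qed
    then have "Inf (enat ` ?A) \<in> enat ` ?A"
      unfolding Inf_enat_def by (metis (lifting) LeastI ex_in_conv)
    moreover have "\<forall>k\<in>?A. enat (Suc n) \<le> enat k"
      unfolding L[symmetric] by (intro ballI Inf_lower imageI)
    ultimately show "Suc n \<in> ?A \<and> (\<forall>k\<in>?A. Suc n \<le> k)"
      unfolding L by auto
  next
    assume "Suc n \<in> ?A \<and> (\<forall>k\<in>?A. Suc n \<le> k)"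
    then show "Inf (enat ` ?A) = enat (Suc n)"
      by (intro antisym Inf_greatest Inf_lower) auto
  qed
  also have "\<dots> \<longleftrightarrow> X (Suc n) \<omega> = M \<omega> \<and> (\<forall>k\<in>{1..n}. X k \<omega> \<noteq> M \<omega>)"
    by (simp only: not_less_eq_eq[symmetric]) auto
  finally show ?thesis
    by (simp add: mixing_time_def)
qed

text \<open>On \<open>M = j\<close> the mixing time is the first passage time to \<open>j\<close>,
  which depends on the path alone, so independence factors out the weight
  \<open>\<pi> $ j\<close>.\<close>

theorem mixing_time_distribution:
  fixes X :: "nat \<Rightarrow> 'w \<Rightarrow> 's::finite"
  assumes chain: "markov_chain \<Omega> X P"
    and mix: "mixing_variable \<Omega> X \<pi> M"
    and start: "\<P>(\<omega> in \<Omega>. X 0 \<omega> = i) > 0"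
  shows "\<P>(\<omega> in \<Omega>. mixing_time X M \<omega> = enat (Suc n) \<bar> X 0 \<omega> = i)
       = (\<Sum>j\<in>UNIV. \<pi> $ j * first_passage P i j n j)"
proof -
  interpret prob_space \<Omega>
    using chain by (simp add: markov_chain_def)
  have X[measurable]: "\<And>n. X n \<in> \<Omega> \<rightarrow>\<^sub>M count_space UNIV"
    using chain by (simp add: markov_chain_def)
  have M[measurable]: "M \<in> \<Omega> \<rightarrow>\<^sub>M count_space UNIV"
    and \<pi>: "\<And>j. \<P>(\<omega> in \<Omega>. M \<omega> = j) = \<pi> $ j"
    and indep: "indep_set (sets (vimage_algebra (space \<Omega>) M (count_space UNIV)))
       (sets (vimage_algebra (space \<Omega>) (\<lambda>\<omega> n. X n \<omega>) (\<Pi>\<^sub>M n\<in>UNIV. count_space UNIV)))"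
    using mix by (auto simp: mixing_variable_def)
  define E where "E j = {\<omega> \<in> space \<Omega>. M \<omega> = j}" for j
  define F where "F j = {\<omega> \<in> space \<Omega>. X 0 \<omega> = i \<and> (\<forall>k\<in>{1..n}. X k \<omega> \<noteq> j) \<and> X (Suc n) \<omega> = j}" for j
  have EF: "E j \<in> sets \<Omega>" "F j \<in> sets \<Omega>" for j
    unfolding E_def F_def by measurable
  have "prob (E j \<inter> F j) = prob (E j) * prob (F j)" for j
  proof (rule indep_setD[OF indep])
    have "E j = M -` {j} \<inter> space \<Omega>"
      by (auto simp: E_def)
    then show "E j \<in> sets (vimage_algebra (space \<Omega>) M (count_space UNIV))"
      by (auto simp: sets_vimage_algebra)
    \<comment> \<open>Independence concerns the sigma-algebra generated by the whole process.
      \<open>F j\<close> belongs to it as the preimage of \<open>?T\<close>, a set of paths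
      constrained at finitely many times.\<close>
    let ?T = "{x \<in> space (\<Pi>\<^sub>M n\<in>UNIV. count_space UNIV).
      x 0 = i \<and> (\<forall>k\<in>{1..n}. x k \<noteq> j) \<and> x (Suc n) = j}"
    have "?T \<in> sets (\<Pi>\<^sub>M n\<in>UNIV. count_space UNIV)"
      by measurable
    moreover have "F j = (\<lambda>\<omega> n. X n \<omega>) -` ?T \<inter> space \<Omega>"
      by (auto simp: F_def space_PiM)
    ultimately show "F j \<in> sets (vimage_algebra (space \<Omega>) (\<lambda>\<omega> n. X n \<omega>) (\<Pi>\<^sub>M n\<in>UNIV. count_space UNIV))"
      by (simp only: in_vimage_algebra)
  qed
  moreover have "{\<omega> \<in> space \<Omega>. mixing_time X M \<omega> = enat (Suc n) \<and> X 0 \<omega> = i} = (\<Union>j\<in>UNIV. E j \<inter> F j)"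
    by (auto simp: mixing_time_eq_enat E_def F_def)
  moreover have "prob (\<Union>j\<in>UNIV. E j \<inter> F j) = (\<Sum>j\<in>UNIV. prob (E j \<inter> F j))"
    using EF by (intro finite_measure_finite_Union) (auto simp: disjoint_family_on_def E_def)
  moreover have "prob (F j) = prob {\<omega> \<in> space \<Omega>. X 0 \<omega> = i} * first_passage P i j n j" for j
    unfolding F_def by (rule prob_first_passage[OF chain])
  moreover have "prob (E j) = \<pi> $ j" for j
    using \<pi> by (simp add: E_def)
  ultimately show ?thesis
    using start by (simp add: cond_prob_def sum_divide_distrib)
qed

section \<open>Recurrences and closed forms for first passage probabilities\<close>

text \<open>The coefficients \<open>A\<close>, \<open>B\<close> of \<open>r ^ n\<close> and
  \<open>- (s ^ n)\<close> solve \<open>A - B = h 0\<close> and \<open>A * r - B * s = h 1\<close>,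
  which has a unique solution for distinct roots.\<close>

lemma second_order_recurrence_solution:
  fixes h :: "nat \<Rightarrow> real"
  assumes rec: "\<And>n. h (Suc (Suc n)) = (r + s) * h (Suc n) - r * s * h n"
    and "r \<noteq> s"
  shows "h n = (h 1 - s * h 0) / (r - s) * r ^ n - (h 1 - r * h 0) / (r - s) * s ^ n"
proof -
  \<comment> \<open>The denominator is cleared, and two consecutive indices are carried because the
    recurrence looks back two steps.\<close>
  have "h n * (r - s) = (h 1 - s * h 0) * r ^ n - (h 1 - r * h 0) * s ^ n
      \<and> h (Suc n) * (r - s) = (h 1 - s * h 0) * r ^ Suc n - (h 1 - r * h 0) * s ^ Suc n"
  proof (induction n)
    case (Suc n)
    have "h (Suc (Suc n)) * (r - s)
        = (r + s) * (h (Suc n) * (r - s)) - r * s * (h n * (r - s))"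
      unfolding rec by (simp add: algebra_simps)
    also have "\<dots> = (h 1 - s * h 0) * r ^ Suc (Suc n) - (h 1 - r * h 0) * s ^ Suc (Suc n)"
      unfolding Suc.IH[THEN conjunct1] Suc.IH[THEN conjunct2] by (simp add: algebra_simps)
    finally show ?case
      using Suc.IH by simp
  qed (simp add: algebra_simps)
  then have "h n = ((h 1 - s * h 0) * r ^ n - (h 1 - r * h 0) * s ^ n) / (r - s)"
    using \<open>r \<noteq> s\<close> by (simp add: eq_divide_eq)
  then show ?thesis
    by (subst (asm) diff_divide_distrib) simp
qed

lemma first_passage_Suc_two:
  assumes "UNIV - {j} = {p, q}" "p \<noteq> q"
  shows "first_passage P i j (Suc n) l
       = first_passage P i j n p * P $ p $ l + first_passage P i j n q * P $ q $ l"
  using assms by simp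

text \<open>Cayley--Hamilton for the restriction of \<open>P\<close> to \<open>{p, q}\<close>.\<close>

lemma first_passage_recurrence:
  assumes pq: "UNIV - {j} = {p, q}" "p \<noteq> q"
  shows "first_passage P i j (Suc (Suc (Suc n))) j
       = (P $ p $ p + P $ q $ q) * first_passage P i j (Suc (Suc n)) j
       - (P $ p $ p * P $ q $ q - P $ p $ q * P $ q $ p) * first_passage P i j (Suc n) j"
  unfolding first_passage_Suc_two[OF pq] by (simp add: algebra_simps)

text \<open>When \<open>i \<noteq> j\<close> the recurrence already holds from index \<open>0\<close>.\<close>

lemma first_passage_recurrence_0:
  assumes pq: "UNIV - {j} = {p, q}" "p \<noteq> q"
  shows "first_passage P p j (Suc (Suc n)) j
       = (P $ p $ p + P $ q $ q) * first_passage P p j (Suc n) j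
       - (P $ p $ p * P $ q $ q - P $ p $ q * P $ q $ p) * first_passage P p j n j"
proof (cases n)
  case 0
  then show ?thesis
    unfolding first_passage_Suc_two[OF pq] by (simp add: algebra_simps)
next
  case (Suc m)
  then show ?thesis
    using first_passage_recurrence[OF pq] by simp
qed

text \<open>The two roots are the eigenvalues of the matrix with diagonal \<open>x\<close>,
  \<open>y\<close> and off-diagonal entries \<open>z\<close>, \<open>w\<close>; the radicand is its
  squared trace minus four times its determinant.\<close>

lemma quadratic_roots_sum_prod:
  fixes x y z w d :: real
  assumes "d = sqrt ((x - y)\<^sup>2 + 4 * z * w)" "d > 0"
  shows "(x + y + d) / 2 + (x + y - d) / 2 = x + y"
    and "(x + y + d) / 2 * ((x + y - d) / 2) = x * y - z * w"
    and "(x + y + d) / 2 \<noteq> (x + y - d) / 2"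
proof -
  \<comment> \<open>The real \<open>sqrt\<close> is odd, so \<open>d > 0\<close> forces a positive
    radicand and squaring recovers it.\<close>
  have "d\<^sup>2 = (x - y)\<^sup>2 + 4 * z * w"
    using assms by simp
  moreover have "(x + y + d) / 2 * ((x + y - d) / 2) = ((x + y)\<^sup>2 - d\<^sup>2) / 4"
    by (simp add: power2_eq_square algebra_simps)
  ultimately show "(x + y + d) / 2 * ((x + y - d) / 2) = x * y - z * w"
    by (simp add: power2_eq_square field_simps)
qed (use assms in \<open>auto simp: field_simps\<close>)

text \<open>With \<open>h n = first_passage P p j n j\<close>, the values \<open>\<alpha> r\<close>
  and \<open>\<alpha> s\<close> are the coefficients \<open>h 1 - s * h 0\<close> and
  \<open>h 1 - r * h 0\<close>: the trace condition replaces \<open>P $ p $ p - s\<close> by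
  \<open>r - P $ q $ q\<close>.\<close>

lemma first_passage_closed_form:
  fixes P :: "real^'s^'s::finite"
  assumes pq: "UNIV - {j} = {p, q}" "p \<noteq> q"
    and tr: "r + s = P $ p $ p + P $ q $ q"
    and det: "r * s = P $ p $ p * P $ q $ q - P $ p $ q * P $ q $ p"
    and "r \<noteq> s"
    and \<alpha>: "\<And>x. \<alpha> x = P $ p $ j * x + P $ p $ q * P $ q $ j - P $ p $ j * P $ q $ q"
  shows "first_passage P p j n j = \<alpha> r / (r - s) * r ^ n - \<alpha> s / (r - s) * s ^ n"
proof -
  have f1: "first_passage P p j 1 j = P $ p $ p * P $ p $ j + P $ p $ q * P $ q $ j"
    using first_passage_Suc_two[OF pq, of P p 0 j] by simp
  have pp: "P $ p $ p = r + s - P $ q $ q"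
    using tr by simp
  have "first_passage P p j 1 j - s * first_passage P p j 0 j = \<alpha> r"
    "first_passage P p j 1 j - r * first_passage P p j 0 j = \<alpha> s"
    unfolding f1 \<alpha> pp by (simp_all add: algebra_simps)
  then show ?thesis
    using second_order_recurrence_solution[of "\<lambda>n. first_passage P p j n j" r s n]
      first_passage_recurrence_0[OF pq, of P] \<open>r \<noteq> s\<close> tr det by simp
qed

text \<open>The direct return \<open>P $ j $ j\<close> makes no excursion through \<open>p\<close>
  and \<open>q\<close> and in general does not fit the recurrence, so the solution starts one index
  later.\<close>

lemma first_return_closed_form:
  fixes P :: "real^'s^'s::finite"
  assumes stoch: "stochastic_matrix P"
    and pq: "UNIV - {j} = {p, q}" "p \<noteq> q"
    and tr: "r + s = P $ p $ p + P $ q $ q"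
    and det: "r * s = P $ p $ p * P $ q $ q - P $ p $ q * P $ q $ p"
    and "r \<noteq> s"
    and \<gamma>: "\<And>x. \<gamma> x = (1 - P $ j $ j) * (1 - P $ p $ p) * (1 - P $ q $ q)
        - P $ p $ q * P $ q $ p * (1 - P $ j $ j)
        - (P $ j $ p * P $ p $ j + P $ j $ q * P $ q $ j) * (1 - x)"
  shows "first_passage P j j (Suc n) j = \<gamma> r / (r - s) * r ^ n - \<gamma> s / (r - s) * s ^ n"
proof -
  have U: "UNIV = {j, p, q}" and jp: "j \<noteq> p" "j \<noteq> q"
    using pq by auto
  have "(\<Sum>l\<in>{j, p, q}. P $ k $ l) = 1" for k
    using stoch by (simp add: stochastic_matrix_def flip: U)
  then have rows: "P $ k $ j + P $ k $ p + P $ k $ q = 1" for k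
    using jp \<open>p \<noteq> q\<close> by (simp add: add.assoc)
  have jj: "P $ j $ j = 1 - P $ j $ p - P $ j $ q"
    and pj: "P $ p $ j = 1 - P $ p $ p - P $ p $ q"
    and qj: "P $ q $ j = 1 - P $ q $ p - P $ q $ q"
    using rows[of j] rows[of p] rows[of q] by simp_all
  define h where "h n = first_passage P j j (Suc n) j" for n
  have h0: "h 0 = P $ j $ p * P $ p $ j + P $ j $ q * P $ q $ j"
    using pq by (simp add: h_def)
  have h1: "h 1 = (P $ j $ p * P $ p $ p + P $ j $ q * P $ q $ p) * P $ p $ j
      + (P $ j $ p * P $ p $ q + P $ j $ q * P $ q $ q) * P $ q $ j"
    using pq by (simp add: h_def)
  have rec: "h (Suc (Suc n)) = (r + s) * h (Suc n) - r * s * h n" for n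
    unfolding h_def tr det by (rule first_passage_recurrence[OF pq])
  \<comment> \<open>Both sides are affine in \<open>x\<close> with slope \<open>h 0\<close>, so the
    content is the value at \<open>x = 1\<close>. Let B be the restriction of \<open>P\<close> to
    \<open>{p, q}\<close>. Since rows sum to one, I - B sends the all-ones vector to the column of
    entries into \<open>j\<close>; hence the row out of \<open>j\<close> times adj(I - B) times that
    column equals \<open>1 - P $ j $ j\<close> times det(I - B).\<close>
  have \<gamma>_h: "\<gamma> x = h 1 - (r + s - x) * h 0" for x
    unfolding h0 h1 \<gamma> tr jj pj qj by (simp add: algebra_simps)
  have "h n = \<gamma> r / (r - s) * r ^ n - \<gamma> s / (r - s) * s ^ n"
    using second_order_recurrence_solution[of h r s n] rec \<open>r \<noteq> s\<close> by (simp add: \<gamma>_h)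
  then show ?thesis
    by (simp only: h_def)
qed

section \<open>The explicit distribution for three states\<close>

theorem theorem4p7:
  fixes \<Omega> :: "'w measure" and X :: "nat \<Rightarrow> 'w \<Rightarrow> 3" and P :: "real^3^3"
    and \<pi> :: "real^3" and M :: "'w \<Rightarrow> 3"
    and g :: "nat \<Rightarrow> real"
    and \<delta>1 \<delta>2 \<delta>3 l12 l13 l21 l23 l31 l32 :: real
    and a b c :: "real \<Rightarrow> real"
  assumes chain: "markov_chain \<Omega> X P"
    and irred: "irreducible_chain P"
    and stat: "stationary_distribution P \<pi>"
    and mix: "mixing_variable \<Omega> X \<pi> M"
    and start: "\<P>(\<omega> in \<Omega>. X 0 \<omega> = 1) > 0"
    and g: "\<And>n. g n = \<P>(\<omega> in \<Omega>. mixing_time X M \<omega> = enat n \<bar> X 0 \<omega> = 1)"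
    and d1: "\<delta>1 = sqrt ((P$2$2 - P$3$3)\<^sup>2 + 4 * P$2$3 * P$3$2)"
    and d2: "\<delta>2 = sqrt ((P$1$1 - P$3$3)\<^sup>2 + 4 * P$1$3 * P$3$1)"
    and d3: "\<delta>3 = sqrt ((P$1$1 - P$2$2)\<^sup>2 + 4 * P$1$2 * P$2$1)"
    and l12: "l12 = (P$2$2 + P$3$3 + \<delta>1) / 2"
    and l13: "l13 = (P$2$2 + P$3$3 - \<delta>1) / 2"
    and l21: "l21 = (P$1$1 + P$3$3 + \<delta>2) / 2"
    and l23: "l23 = (P$1$1 + P$3$3 - \<delta>2) / 2"
    and l31: "l31 = (P$1$1 + P$2$2 + \<delta>3) / 2"
    and l32: "l32 = (P$1$1 + P$2$2 - \<delta>3) / 2"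
    and a: "\<And>l. a l = P$1$2 * l + P$1$3 * P$3$2 - P$1$2 * P$3$3"
    and b: "\<And>l. b l = P$1$3 * l + P$1$2 * P$2$3 - P$1$3 * P$2$2"
    and c: "\<And>l. c l = (1 - P$1$1) * (1 - P$2$2) * (1 - P$3$3) - P$2$3 * P$3$2 * (1 - P$1$1)
                     - (P$1$2 * P$2$1 + P$1$3 * P$3$1) * (1 - l)"
  shows "g 1 = \<pi>$1 * P$1$1 + \<pi>$2 * P$1$2 + \<pi>$3 * P$1$3
    \<and> g 2 = \<pi>$1 * (P$1$2 * P$2$1 + P$1$3 * P$3$1)
          + \<pi>$2 * (P$1$1 * P$1$2 + P$1$3 * P$3$2)
          + \<pi>$3 * (P$1$1 * P$1$3 + P$1$2 * P$2$3)
    \<and> (\<delta>1 > 0 \<and> \<delta>2 > 0 \<and> \<delta>3 > 0 \<longrightarrow>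
        (\<forall>n\<ge>3. g n =
            \<pi>$1 * (c l12 / (l12 - l13) * l12 ^ (n - 2) - c l13 / (l12 - l13) * l13 ^ (n - 2))
          + \<pi>$2 * (a l21 / (l21 - l23) * l21 ^ (n - 1) - a l23 / (l21 - l23) * l23 ^ (n - 1))
          + \<pi>$3 * (b l31 / (l31 - l32) * l31 ^ (n - 1) - b l32 / (l31 - l32) * l32 ^ (n - 1))))"
proof -
  have ne: "(1::3) \<noteq> 2" "(1::3) \<noteq> 3" "(2::3) \<noteq> 3"
    by simp_all
  \<comment> \<open>The order within each pair matters: for the targets \<open>2\<close> and
    \<open>3\<close> the starting state \<open>1\<close> comes first and takes the role of
    \<open>p\<close>.\<close>
  have U: "UNIV - {1::3} = {2, 3}" "UNIV - {2::3} = {1, 3}" "UNIV - {3::3} = {1, 2}"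
    unfolding UNIV_3 using ne ne[symmetric] by blast+
  have stoch: "stochastic_matrix P"
    using chain by (simp add: markov_chain_def)
  have G: "g (Suc n) = \<pi>$1 * first_passage P 1 1 n 1 + \<pi>$2 * first_passage P 1 2 n 2
      + \<pi>$3 * first_passage P 1 3 n 3" for n
    unfolding g mixing_time_distribution[OF chain mix start] by (simp add: sum_3)
  have g1: "g 1 = \<pi>$1 * P$1$1 + \<pi>$2 * P$1$2 + \<pi>$3 * P$1$3"
    using G[of 0] by simp
  have g2: "g 2 = \<pi>$1 * (P$1$2 * P$2$1 + P$1$3 * P$3$1)
          + \<pi>$2 * (P$1$1 * P$1$2 + P$1$3 * P$3$2)
          + \<pi>$3 * (P$1$1 * P$1$3 + P$1$2 * P$2$3)"
    unfolding numeral_2_eq_2 G first_passage_Suc_two[OF U(1) ne(3)] first_passage_Suc_two[OF U(2) ne(2)]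
      first_passage_Suc_two[OF U(3) ne(1)]
    by simp
  have "g n = \<pi>$1 * (c l12 / (l12 - l13) * l12 ^ (n - 2) - c l13 / (l12 - l13) * l13 ^ (n - 2))
          + \<pi>$2 * (a l21 / (l21 - l23) * l21 ^ (n - 1) - a l23 / (l21 - l23) * l23 ^ (n - 1))
          + \<pi>$3 * (b l31 / (l31 - l32) * l31 ^ (n - 1) - b l32 / (l31 - l32) * l32 ^ (n - 1))"
    if pos: "\<delta>1 > 0" "\<delta>2 > 0" "\<delta>3 > 0" and n: "n \<ge> 3" for n
  proof -
    \<comment> \<open>The closed form for the return to \<open>1\<close> starts at time 2, those for
      the passages to \<open>2\<close> and \<open>3\<close> at time 1; hence the exponents
      \<open>n - 2\<close> and \<open>n - 1\<close>, here \<open>m\<close> and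
      \<open>Suc m\<close>.\<close>
    define m where "m = n - 2"
    with n have m: "n = Suc (Suc m)"
      by simp
    note r1 = quadratic_roots_sum_prod[OF d1 pos(1), folded l12 l13]
    note r2 = quadratic_roots_sum_prod[OF d2 pos(2), folded l21 l23]
    note r3 = quadratic_roots_sum_prod[OF d3 pos(3), folded l31 l32]
    have "first_passage P 1 1 (Suc m) 1 = c l12 / (l12 - l13) * l12 ^ m - c l13 / (l12 - l13) * l13 ^ m"
      by (rule first_return_closed_form[OF stoch U(1) ne(3) r1 c])
    moreover have "first_passage P 1 2 (Suc m) 2
        = a l21 / (l21 - l23) * l21 ^ Suc m - a l23 / (l21 - l23) * l23 ^ Suc m"
      by (rule first_passage_closed_form[OF U(2) ne(2) r2 a])
    moreover have "first_passage P 1 3 (Suc m) 3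
        = b l31 / (l31 - l32) * l31 ^ Suc m - b l32 / (l31 - l32) * l32 ^ Suc m"
      by (rule first_passage_closed_form[OF U(3) ne(1) r3 b])
    ultimately show ?thesis
      unfolding m G by (simp only: diff_Suc_Suc diff_Suc_1 numeral_2_eq_2 diff_zero)
  qed
  with g1 g2 show ?thesis
    by blast
qed

end
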